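(* Let $n\geq 3$ be an integer. The isomorphism relation on countable $K_n$-free graphs is Borel reducible to the conjugacy relation on $\mathrm{Aut}(\Gamma_n)$. Hence the conjugacy relation on $\mathrm{Aut}(\Gamma_n)$ is Borel complete.
   Context: $K_n$ is the complete graph on $n$ vertices; a graph is $K_n$-free if it contains no copy of $K_n$. $\Gamma_n$ is the generic countable $K_n$-free graph: the unique countable homogeneous undirected graph whose finite induced subgraphs are exactly the finite $K_n$-free graphs (equivalently, every finite subgraph is $K_n$-free and whenever $S\subset\Gamma_n$ finite and $S\cup\{x\}$ is a $K_n$-free one-point extension, there is $a\in\Gamma_n$ realizing it over $S$). The isomorphism relation is on the standard Borel space of $K_n$-free graphs on $\mathbb{N}$; the conjugacy relation on $\mathrm{Aut}(\Gamma_n)$ identifies $\phi,\psi$ iff $\psi=\delta\phi\delta^{-1}$ for some $\delta\in\mathrm{Aut}(\Gamma_n)$. $E\leq_B F$ means there is a Borel $f$ with $x\mathrel{E}x'\iff f(x)\mathrel{F}f(x')$; $E$ is Borel complete if isomorphism on every Borel class of countable structures in a countable relational language is Borel reducible to $E$. *)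

theory Defs
  imports "HOL-Analysis.Analysis"
begin

text \<open>
  A Borel space is given as a measure space of which only the carrier and the sigma-algebra
  matter. All concrete spaces below are of the form \<open>restrict_space borel X\<close>, where
  \<open>borel\<close> is taken on a function type with the product topology of discrete spaces
  (\<open>nat\<close> and \<open>bool\<close> carry the discrete topology).
\<close>

definition borel_reducible ::
  "'a measure \<Rightarrow> ('a \<Rightarrow> 'a \<Rightarrow> bool) \<Rightarrow> 'b measure \<Rightarrow> ('b \<Rightarrow> 'b \<Rightarrow> bool) \<Rightarrow> bool" where
  "borel_reducible M E N F \<longleftrightarrow>
     (\<exists>f \<in> measurable M N. \<forall>x \<in> space M. \<forall>y \<in> space M. E x y \<longleftrightarrow> F (f x) (f y))"

text \<open>
  A countable relational language is a partial arity function: its symbols are the elements of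
  \<open>dom L\<close>, and \<open>L i = Some k\<close> means that symbol \<open>i\<close> is \<open>k\<close>-ary. A structure with universe
  \<open>\<nat>\<close> maps each symbol to the set of tuples satisfying it; the value is \<open>False\<close> on
  non-symbols and on lists of the wrong length, so that each structure has a unique code.
\<close>

type_synonym lang = "nat \<Rightarrow> nat option"

type_synonym struct = "nat \<Rightarrow> nat list \<Rightarrow> bool"

definition structures :: "lang \<Rightarrow> struct set" where
  "structures L = {M. \<forall>i xs. M i xs \<longrightarrow> L i = Some (length xs)}"

definition struct_isomorphic :: "struct \<Rightarrow> struct \<Rightarrow> bool" where
  "struct_isomorphic M N \<longleftrightarrow> (\<exists>g. bij g \<and> (\<forall>i xs. M i xs \<longleftrightarrow> N i (map g xs)))"

definition borel_class :: "lang \<Rightarrow> struct set \<Rightarrow> bool" where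
  "borel_class L C \<longleftrightarrow>
     C \<subseteq> structures L \<and> C \<in> sets borel \<and>
     (\<forall>M \<in> C. \<forall>N \<in> structures L. struct_isomorphic M N \<longrightarrow> N \<in> C)"

definition borel_complete :: "'a measure \<Rightarrow> ('a \<Rightarrow> 'a \<Rightarrow> bool) \<Rightarrow> bool" where
  "borel_complete X F \<longleftrightarrow>
     (\<forall>L C. borel_class L C \<longrightarrow>
        borel_reducible (restrict_space borel C) struct_isomorphic X F)"

text \<open>
  In the following a graph is a vertex set \<open>V\<close> together with an adjacency relation \<open>E\<close>,
  of which only the restriction to \<open>V\<close> matters. Thus \<open>A\<close> with \<open>E\<close>, for \<open>A \<subseteq> V\<close>, is
  the induced subgraph on \<open>A\<close>.
\<close>

definition simple_graph :: "'a set \<Rightarrow> ('a \<Rightarrow> 'a \<Rightarrow> bool) \<Rightarrow> bool" where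
  "simple_graph V E \<longleftrightarrow> irreflp_on V E \<and> symp_on V E"

definition clique_free :: "nat \<Rightarrow> 'a set \<Rightarrow> ('a \<Rightarrow> 'a \<Rightarrow> bool) \<Rightarrow> bool" where
  "clique_free n V E \<longleftrightarrow>
     \<not> (\<exists>K \<subseteq> V. finite K \<and> card K = n \<and> (\<forall>x \<in> K. \<forall>y \<in> K. x \<noteq> y \<longrightarrow> E x y))"

definition graph_iso ::
  "('a \<Rightarrow> 'b) \<Rightarrow> 'a set \<Rightarrow> ('a \<Rightarrow> 'a \<Rightarrow> bool) \<Rightarrow> 'b set \<Rightarrow> ('b \<Rightarrow> 'b \<Rightarrow> bool) \<Rightarrow> bool" where
  "graph_iso f V E W F \<longleftrightarrow>
     bij_betw f V W \<and> (\<forall>x \<in> V. \<forall>y \<in> V. E x y \<longleftrightarrow> F (f x) (f y))"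

definition aut :: "('a \<Rightarrow> 'a \<Rightarrow> bool) \<Rightarrow> ('a \<Rightarrow> 'a) set" where
  "aut E = {f. graph_iso f UNIV E UNIV E}"

definition homogeneous :: "('a \<Rightarrow> 'a \<Rightarrow> bool) \<Rightarrow> bool" where
  "homogeneous E \<longleftrightarrow>
     (\<forall>A B f. finite A \<longrightarrow> graph_iso f A E B E \<longrightarrow> (\<exists>g \<in> aut E. \<forall>x \<in> A. g x = f x))"

text \<open>
  The predicate \<open>generic_clique_free n\<close> holds of the copies of \<open>\<Gamma>\<^sub>n\<close> with vertex set \<open>\<nat>\<close>.
  Every finite graph is isomorphic to one whose vertices are natural numbers.
\<close>

definition generic_clique_free :: "nat \<Rightarrow> (nat \<Rightarrow> nat \<Rightarrow> bool) \<Rightarrow> bool" where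
  "generic_clique_free n E \<longleftrightarrow>
     simple_graph UNIV E \<and> homogeneous E \<and>
     (\<forall>(V :: nat set) F. finite V \<longrightarrow> simple_graph V F \<longrightarrow>
        ((\<exists>A f. graph_iso f V F A E) \<longleftrightarrow> clique_free n V F))"

definition clique_free_graphs :: "nat \<Rightarrow> (nat \<Rightarrow> nat \<Rightarrow> bool) measure" where
  "clique_free_graphs n = restrict_space borel {E. simple_graph UNIV E \<and> clique_free n UNIV E}"

definition graph_isomorphic :: "('a \<Rightarrow> 'a \<Rightarrow> bool) \<Rightarrow> ('a \<Rightarrow> 'a \<Rightarrow> bool) \<Rightarrow> bool" where
  "graph_isomorphic E F \<longleftrightarrow> (\<exists>f. graph_iso f UNIV E UNIV F)"

text \<open>The subspace topology from the product topology on \<open>nat \<Rightarrow> nat\<close> is the usual Polish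
  topology of pointwise convergence on the automorphism group.\<close>

definition aut_space :: "(nat \<Rightarrow> nat \<Rightarrow> bool) \<Rightarrow> (nat \<Rightarrow> nat) measure" where
  "aut_space E = restrict_space borel (aut E)"

definition conjugate_in :: "('a \<Rightarrow> 'a) set \<Rightarrow> ('a \<Rightarrow> 'a) \<Rightarrow> ('a \<Rightarrow> 'a) \<Rightarrow> bool" where
  "conjugate_in G \<phi> \<psi> \<longleftrightarrow> (\<exists>\<delta> \<in> G. \<psi> = \<delta> \<circ> \<phi> \<circ> inv \<delta>)"

end

(*
  Extend a K_n-free graph G by adding, for every finite set S of vertices constructed so far and
  every natural number i, a vertex joined exactly to S whenever S contains no K_{n-1}. The result
  has the extension property characterising Gamma_n. Exchanging the indices 2i and 2i+1 of the new
  vertices at every level is an automorphism whose set of fixed points is G, so G is recovered from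
  its conjugacy class; conversely isomorphisms of G lift canonically and commute with this
  automorphism. A canonical back-and-forth transports the picture to Gamma_n in a Borel way.

  A structure is coded by the bipartite incidence graph between elements, tuples, positions in
  tuples and symbols. The colour of a vertex is recorded as its number of adjacent leaves.
*)

theory Submission
  imports Defs
begin

section \<open>Borel reductions and the extension property\<close>

text \<open>The vertex set of the extension and its automorphism have to be the same for all G.
  Hence a set S containing a K_{n-1} is not discarded: its vertices are kept, without edges to
  smaller vertices, and one coding by numbers serves every G. The infinitely many indices have two
  uses: they supply vertices over S outside any prescribed finite set, and they leave room for a
  permutation that touches nothing but indices. Lifts of base isomorphisms keep all indices, so they
  commute with it. The isomorphism onto \<open>\<Gamma>\<close> involves choices, but another choice
  only replaces the transported automorphism by a conjugate. What matters is that it depends on G in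
  a Borel way, which least choices ensure. The coding of structures is bipartite, hence
  triangle-free; this is where n >= 3 enters.\<close>

instance bool :: second_countable_topology
proof
  show "\<exists>B :: bool set set. countable B \<and> open = generate_topology B"
    \<comment> \<open>The rays are the two singletons. Second countability allows Borel
      measurability into a space of relations to be checked coordinatewise.\<close>
    by (rule exI[of _ "range lessThan \<union> range greaterThan"]) (auto intro: countable_Un simp: open_bool_def)
qed

section \<open>Measurability into discrete and relation spaces\<close>

lemma borel_measurable_countable_discrete:
  "(f \<in> M \<rightarrow>\<^sub>M (borel :: 'b::{countable, t2_space} measure)) \<longleftrightarrow> f \<in> M \<rightarrow>\<^sub>M count_space UNIV"
proof -
  have "M \<rightarrow>\<^sub>M (borel :: 'b measure) = M \<rightarrow>\<^sub>M count_space UNIV"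
    by (rule measurable_cong_sets) (simp_all add: sets_borel_eq_count_space)
  then show ?thesis by simp
qed

lemma borel_measurable_relationI:
  fixes f :: "'m \<Rightarrow> 'a::countable \<Rightarrow> 'b::countable \<Rightarrow> bool"
  assumes "\<And>a b. Measurable.pred M (\<lambda>x. f x a b)"
  shows "f \<in> borel_measurable M"
  using assms
  by (intro measurable_coordinatewise_then_product) (simp add: borel_measurable_countable_discrete)

lemma pred_borel_coordinate:
  fixes f :: "'m \<Rightarrow> 'a::countable \<Rightarrow> 'b::countable \<Rightarrow> bool"
  assumes "f \<in> borel_measurable M"
  shows "Measurable.pred M (\<lambda>x. f x a b)"
  using measurable_product_then_coordinatewise[OF measurable_product_then_coordinatewise[OF assms]]
  by (simp flip: borel_measurable_countable_discrete)

lemma borel_reducible_trans: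
  assumes "borel_reducible M E N F" "borel_reducible N F P G"
  shows "borel_reducible M E P G"
proof -
  obtain f g where f: "f \<in> M \<rightarrow>\<^sub>M N" "\<And>x y. x \<in> space M \<Longrightarrow> y \<in> space M \<Longrightarrow> E x y \<longleftrightarrow> F (f x) (f y)"
    and g: "g \<in> N \<rightarrow>\<^sub>M P" "\<And>x y. x \<in> space N \<Longrightarrow> y \<in> space N \<Longrightarrow> F x y \<longleftrightarrow> G (g x) (g y)"
    using assms unfolding borel_reducible_def by blast
  show ?thesis
    unfolding borel_reducible_def
    using f g by (intro bexI[of _ "g \<circ> f"]) (auto simp: measurable_space)
qed

section \<open>Graph isomorphisms and cliques\<close>

lemma graph_iso_comp:
  assumes "graph_iso f U D V E" "graph_iso g V E W F"
  shows "graph_iso (g \<circ> f) U D W F"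
proof -
  have "bij_betw (g \<circ> f) U W"
    using assms bij_betw_trans unfolding graph_iso_def by blast
  moreover have "f x \<in> V" if "x \<in> U" for x
    using assms(1) that unfolding graph_iso_def bij_betw_def by blast
  ultimately show ?thesis
    using assms unfolding graph_iso_def by simp
qed

lemma graph_iso_inv:
  assumes "graph_iso f UNIV E UNIV F"
  shows "graph_iso (inv f) UNIV F UNIV E"
proof -
  have "bij f" using assms by (simp add: graph_iso_def)
  then show ?thesis
    using assms by (simp add: graph_iso_def bij_imp_bij_inv bij_is_surj surj_f_inv_f)
qed

lemma clique_free_embedding:
  assumes iso: "graph_iso f V E W F" and free: "clique_free n W F"
  shows "clique_free n V E"
  unfolding clique_free_def
proof (rule notI, elim exE conjE)
  fix K assume K: "K \<subseteq> V" "finite K" "card K = n" "\<forall>x\<in>K. \<forall>y\<in>K. x \<noteq> y \<longrightarrow> E x y"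
  have inj: "inj_on f K"
    using iso K(1) inj_on_subset by (auto simp: graph_iso_def bij_betw_def)
  have "f ` K \<subseteq> W"
    using iso K(1) by (auto simp: graph_iso_def bij_betw_def)
  moreover have "F x' y'" if "x' \<in> f ` K" "y' \<in> f ` K" "x' \<noteq> y'" for x' y'
  proof -
    obtain x y where "x \<in> K" "y \<in> K" "x' = f x" "y' = f y" using \<open>x' \<in> _\<close> \<open>y' \<in> _\<close> by auto
    moreover from this have "x \<noteq> y" using \<open>x' \<noteq> y'\<close> by auto
    ultimately have "E x y" using K(4) by blast
    moreover have "x \<in> V" "y \<in> V" using K(1) \<open>x \<in> K\<close> \<open>y \<in> K\<close> by auto
    ultimately show ?thesis using iso \<open>x' = f x\<close> \<open>y' = f y\<close> by (simp add: graph_iso_def)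
  qed
  moreover have "card (f ` K) = n" using K(3) inj by (simp add: card_image)
  ultimately show False
    using free K(2) unfolding clique_free_def by blast
qed

lemma graph_iso_the_inv_into:
  assumes "graph_iso f V E W F"
  shows "graph_iso (the_inv_into V f) W F V E"
proof -
  have bij: "bij_betw f V W" using assms by (simp add: graph_iso_def)
  have "f (the_inv_into V f y) = y" "the_inv_into V f y \<in> V" if "y \<in> W" for y
    using bij that f_the_inv_into_f_bij_betw bij_betw_the_inv_into bij_betwE by metis+
  then show ?thesis
    using assms bij_betw_the_inv_into[OF bij] by (simp add: graph_iso_def)
qed

lemma clique_free_graph_iso:
  "graph_iso f V E W F \<Longrightarrow> clique_free n V E \<longleftrightarrow> clique_free n W F"
  by (metis clique_free_embedding graph_iso_the_inv_into)

lemma clique_free_subset: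
  "clique_free n V E \<Longrightarrow> U \<subseteq> V \<Longrightarrow> clique_free n U E"
  unfolding clique_free_def by blast

section \<open>The one-point extension property of the generic graph\<close>

definition clique_free_extension :: "nat \<Rightarrow> ('a \<Rightarrow> 'a \<Rightarrow> bool) \<Rightarrow> bool" where
  "clique_free_extension n E \<longleftrightarrow>
     (\<forall>A S. finite A \<longrightarrow> S \<subseteq> A \<longrightarrow> clique_free (n - 1) S E \<longrightarrow>
        (\<exists>x. x \<notin> A \<and> (\<forall>y\<in>A. E x y \<longleftrightarrow> y \<in> S)))"

text \<open>A clique among the neighbours of x grows by x itself. This is why the extension property
  asks S to avoid cliques of size n - 1.\<close>

lemma clique_free_neighbours:
  assumes "simple_graph UNIV E" "clique_free n UNIV E" "n \<ge> 1"
  shows "clique_free (n - 1) {y. E x y} E"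
  unfolding clique_free_def
proof (rule notI, elim exE conjE)
  fix K assume K: "K \<subseteq> {y. E x y}" "finite K" "card K = n - 1"
    "\<forall>x\<in>K. \<forall>y\<in>K. x \<noteq> y \<longrightarrow> E x y"
  have "x \<notin> K" "symp E"
    using K(1) assms(1) by (auto simp: simple_graph_def irreflp_on_def)
  then have "card (insert x K) = n"
    using K(2,3) assms(3) by simp
  moreover have "E u v" if "u \<in> insert x K" "v \<in> insert x K" "u \<noteq> v" for u v
  proof -
    have "E x w" "E w x" if "w \<in> K" for w
      using K(1) that sympD[OF \<open>symp E\<close>] by blast+
    then show ?thesis using K(4) that by blast
  qed
  moreover have "finite (insert x K)" using K(2) by simp
  ultimately show False
    using assms(2) unfolding clique_free_def by blast
qed

lemma generic_clique_free_UNIV: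
  assumes "generic_clique_free n \<Gamma>"
  shows "clique_free n UNIV \<Gamma>"
proof -
  have "clique_free n K \<Gamma>" if "finite K" for K
  proof -
    have "simple_graph K \<Gamma>"
      using assms by (auto simp: generic_clique_free_def simple_graph_def irreflp_on_def symp_on_def)
    moreover have "graph_iso id K \<Gamma> K \<Gamma>"
      by (simp add: graph_iso_def)
    ultimately show ?thesis
      using assms that unfolding generic_clique_free_def by blast
  qed
  then show ?thesis unfolding clique_free_def by blast
qed

text \<open>The wanted one-point extension of A is an abstract finite graph, so some copy of it lies
  in \<open>\<Gamma>\<close>; homogeneity moves the copy of A back onto A, taking the extra vertex
  along.\<close>

lemma generic_clique_free_extension:
  assumes "generic_clique_free n \<Gamma>" "n \<ge> 1"
  shows "clique_free_extension n \<Gamma>"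
  unfolding clique_free_extension_def
proof (intro allI impI)
  fix A S :: "nat set"
  assume A: "finite A" "S \<subseteq> A" and S: "clique_free (n - 1) S \<Gamma>"
  have \<Gamma>: "irreflp \<Gamma>" "symp \<Gamma>" and hom: "homogeneous \<Gamma>"
    using assms(1) by (auto simp: generic_clique_free_def simple_graph_def)
  obtain m where m: "m \<notin> A"
    using A(1) ex_new_if_finite infinite_UNIV_nat by blast
  \<comment> \<open>m is only a name for the new vertex; its edges in \<open>\<Gamma>\<close> are
    overwritten.\<close>
  define F where "F = (\<lambda>x y. if x = m then y \<in> S else if y = m then x \<in> S else \<Gamma> x y)"
  have "simple_graph (insert m A) F"
    using m A(2) \<Gamma> by (auto simp: simple_graph_def F_def irreflp_on_def symp_on_def)
  moreover have "clique_free n (insert m A) F"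
    unfolding clique_free_def
  proof (rule notI, elim exE conjE)
    fix K assume K: "K \<subseteq> insert m A" "finite K" "card K = n"
      "\<forall>x\<in>K. \<forall>y\<in>K. x \<noteq> y \<longrightarrow> F x y"
    show False
    proof (cases "m \<in> K")
      case True
      have "K - {m} \<subseteq> S" "\<forall>x\<in>K - {m}. \<forall>y\<in>K - {m}. x \<noteq> y \<longrightarrow> \<Gamma> x y"
        using K True by (auto simp: F_def split: if_splits)
      moreover have "card (K - {m}) = n - 1" using True K by simp
      ultimately show False using S K(2) unfolding clique_free_def by blast
    next
      case False
      then have "F x y \<longleftrightarrow> \<Gamma> x y" if "x \<in> K" "y \<in> K" for x y
        using that by (auto simp: F_def)
      with K(4) have "\<forall>x\<in>K. \<forall>y\<in>K. x \<noteq> y \<longrightarrow> \<Gamma> x y" by blast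
      then show False
        using K(2,3) generic_clique_free_UNIV[OF assms(1)] unfolding clique_free_def by blast
    qed
  qed
  moreover have "finite (insert m A)" using A(1) by simp
  ultimately have "\<exists>B f. graph_iso f (insert m A) F B \<Gamma>"
    using assms(1) unfolding generic_clique_free_def by blast
  then obtain B f where f: "graph_iso f (insert m A) F B \<Gamma>" by blast
  have "\<forall>x\<in>A. \<forall>y\<in>A. \<Gamma> x y \<longleftrightarrow> \<Gamma> (f x) (f y)"
  proof (intro ballI)
    fix x y assume "x \<in> A" "y \<in> A"
    moreover from this have "F x y \<longleftrightarrow> \<Gamma> x y" using m by (auto simp: F_def)
    ultimately show "\<Gamma> x y \<longleftrightarrow> \<Gamma> (f x) (f y)" using f by (simp add: graph_iso_def)
  qed
  moreover have inj: "inj_on f (insert m A)"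
    using f by (simp add: graph_iso_def bij_betw_def)
  ultimately have "graph_iso f A \<Gamma> (f ` A) \<Gamma>"
    by (simp add: graph_iso_def bij_betw_def)
  with hom A(1) obtain g where g: "g \<in> aut \<Gamma>" "\<forall>x\<in>A. g x = f x"
    unfolding homogeneous_def by blast
  have g': "bij g" "\<And>x y. \<Gamma> x y \<longleftrightarrow> \<Gamma> (g x) (g y)"
    using g(1) by (auto simp: aut_def graph_iso_def)
  obtain x where x: "g x = f m" using g'(1) by (metis bij_pointE)
  have "x \<notin> A" using x g(2) inj m by (metis inj_on_def insertCI)
  moreover have "\<Gamma> x y \<longleftrightarrow> y \<in> S" if "y \<in> A" for y
  proof -
    have "\<Gamma> x y \<longleftrightarrow> \<Gamma> (f m) (f y)" using g'(2) x g(2) that by metis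
    also have "\<dots> \<longleftrightarrow> F m y" using f that by (simp add: graph_iso_def)
    finally show ?thesis by (simp add: F_def)
  qed
  ultimately show "\<exists>x. x \<notin> A \<and> (\<forall>y\<in>A. \<Gamma> x y \<longleftrightarrow> y \<in> S)" by blast
qed

section \<open>A free extension of a graph with a generic automorphism\<close>

text \<open>
  Every natural number is either a base vertex or a vertex \<open>ext S i\<close> for a unique finite set
  \<open>S\<close> and index \<open>i\<close>; the members of \<open>S\<close> are then smaller than \<open>ext S i\<close>. Since this
  vertex set does not depend on the graph \<open>G\<close> put on the base vertices, neither does the
  automorphism \<open>shift\<close>.
\<close>

definition base :: "nat \<Rightarrow> nat" where "base a = 2 * a"

text \<open>\<open>set_encode\<close> is the binary code of a finite set and
  \<open>prod_encode\<close> a pairing bijection. Both dominate their arguments, so recursion on the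
  numerical order reaches the members of a vertex.\<close>

definition ext :: "nat set \<Rightarrow> nat \<Rightarrow> nat" where
  "ext S i = 2 * prod_encode (set_encode S, i) + 1"

definition members :: "nat \<Rightarrow> nat set" where
  "members v = set_decode (fst (prod_decode (v div 2)))"

definition index :: "nat \<Rightarrow> nat" where
  "index v = snd (prod_decode (v div 2))"

lemma base_simps [simp]: "even (base a)" "base a div 2 = a" "base a = base b \<longleftrightarrow> a = b"
  by (auto simp: base_def)

lemma ext_simps [simp]:
  "odd (ext S i)" "index (ext S i) = i" "finite S \<Longrightarrow> members (ext S i) = S"
  by (simp_all add: ext_def members_def index_def)

lemma finite_members [simp]: "finite (members v)"
  by (simp add: members_def)

lemma base_neq_ext [simp]: "base a \<noteq> ext S i" "ext S i \<noteq> base a"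
  using base_simps(1) ext_simps(1) by metis+

lemma ext_inject: "finite S \<Longrightarrow> finite T \<Longrightarrow> ext S i = ext T j \<longleftrightarrow> S = T \<and> i = j"
  by (metis ext_simps(2,3))

lemma vertex_cases:
  obtains (base) a where "v = base a" | (ext) S i where "finite S" "v = ext S i"
proof (cases "even v")
  case True
  then have "v = base (v div 2)" by (simp add: base_def)
  then show ?thesis using base by blast
next
  case False
  then have "v = ext (members v) (index v)"
    by (simp add: ext_def members_def index_def)
  then show ?thesis using ext finite_members by blast
qed

lemma less_set_encode: "x \<in> set_decode m \<Longrightarrow> x < m"
proof -
  assume "x \<in> set_decode m"
  then have "m div 2 ^ x \<noteq> 0" by (auto simp: set_decode_def intro!: odd_pos)
  then have "2 ^ x \<le> m" by (meson div_less not_le)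
  then show "x < m" using less_exp[of x] by (rule order.strict_trans2[rotated])
qed

lemma members_less: "x \<in> members v \<Longrightarrow> odd v \<Longrightarrow> x < v"
proof -
  assume x: "x \<in> members v" and v: "odd v"
  have "x < fst (prod_decode (v div 2))" using x less_set_encode by (simp add: members_def)
  also have "\<dots> \<le> v div 2" by (metis le_prod_encode_1 prod.collapse prod_decode_inverse)
  also have "\<dots> \<le> v" by simp
  finally show "x < v" .
qed

lemma mem_less_ext: "finite S \<Longrightarrow> x \<in> S \<Longrightarrow> x < ext S i"
  using members_less[of x "ext S i"] by simp

lemma index_less_ext: "i < ext S i"
  using le_prod_encode_2[of i "set_encode S"] by (simp add: ext_def)

text \<open>
  The vertex \<open>ext S i\<close> is joined exactly to \<open>S\<close> if this creates no clique, and to none of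
  the smaller vertices otherwise.
\<close>

function lower :: "nat \<Rightarrow> (nat \<Rightarrow> nat \<Rightarrow> bool) \<Rightarrow> nat \<Rightarrow> nat set" where
  "lower n G v =
     (if even v then base ` {b. G (v div 2) b}
      else if \<exists>K\<in>{K \<in> Pow (members v). card K = n - 1}.
                \<forall>x\<in>K. \<forall>y\<in>K. x \<noteq> y \<longrightarrow> x \<in> lower n G y \<or> y \<in> lower n G x
           then {} else members v)"
  by pat_completeness auto
text \<open>The clique test is spelled out with bounded quantifiers over subsets of
  \<open>members v\<close>, so every recursive call is visibly at a member of an odd v, which is
  smaller.\<close>

termination
  by (relation "Wellfounded.measure (\<lambda>(n, G, v). v)") (auto simp: members_less)

declare lower.simps [simp del]

text \<open>An edge at an \<open>ext\<close> vertex is recorded only at its larger end, hence the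
  disjunction; between base vertices \<open>lower\<close> already lists all G-neighbours.\<close>

definition adj :: "nat \<Rightarrow> (nat \<Rightarrow> nat \<Rightarrow> bool) \<Rightarrow> nat \<Rightarrow> nat \<Rightarrow> bool" where
  "adj n G x y \<longleftrightarrow> x \<in> lower n G y \<or> y \<in> lower n G x"

lemma lower_base: "lower n G (base a) = base ` {b. G a b}"
  by (subst lower.simps) simp

lemma lower_ext:
  assumes "finite S"
  shows "lower n G (ext S i) = (if clique_free (n - 1) S (adj n G) then S else {})"
proof -
  have "(\<exists>K\<in>{K \<in> Pow S. card K = n - 1}. \<forall>x\<in>K. \<forall>y\<in>K. x \<noteq> y \<longrightarrow> adj n G x y)
    \<longleftrightarrow> \<not> clique_free (n - 1) S (adj n G)"
    using assms finite_subset unfolding clique_free_def by blast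
  then show ?thesis
    using assms by (subst lower.simps) (simp add: adj_def)
qed

text \<open>Consequently the neighbours of an odd x below x are exactly the elements of
  \<open>lower n G x\<close>.\<close>

lemma odd_not_in_lower: "x \<notin> lower n G y" if "odd x" "y \<le> x"
proof (cases y rule: vertex_cases)
  case (base a)
  then show ?thesis using that by (auto simp: lower_base)
next
  case (ext S i)
  then show ?thesis using that mem_less_ext[of S x i] by (auto simp: lower_ext)
qed

lemma adj_base: "symp G \<Longrightarrow> adj n G (base a) (base b) \<longleftrightarrow> G a b"
  by (auto simp: adj_def lower_base dest: sympD)

lemma simple_graph_adj:
  assumes "simple_graph UNIV G"
  shows "simple_graph UNIV (adj n G)"
proof -
  have "x \<notin> lower n G x" for x
  proof (cases x rule: vertex_cases)
    case (base a)
    then show ?thesis using assms by (auto simp: lower_base simple_graph_def irreflp_on_def)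
  qed (simp add: odd_not_in_lower)
  then show ?thesis
    by (auto simp: simple_graph_def adj_def irreflp_on_def symp_on_def)
qed

text \<open>The largest odd vertex v of a clique has the rest of the clique in
  \<open>lower n G v\<close>, which contains no K_{n-1}. A clique without odd vertices is a clique
  of G.\<close>

lemma clique_free_adj:
  assumes "simple_graph UNIV G" "clique_free n UNIV G" "n \<ge> 1"
  shows "clique_free n UNIV (adj n G)"
  unfolding clique_free_def
proof (rule notI, elim exE conjE)
  fix K assume K: "finite K" "card K = n" "\<forall>x\<in>K. \<forall>y\<in>K. x \<noteq> y \<longrightarrow> adj n G x y"
  have sym: "symp G" using assms(1) by (simp add: simple_graph_def)
  show False
  proof (cases "\<exists>v\<in>K. odd v")
    case True
    define v where "v = Max {v \<in> K. odd v}"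
    have "v \<in> {v \<in> K. odd v}"
      unfolding v_def using True K(1) by (intro Max_in) auto
    then have v: "v \<in> K" "odd v" by auto
    have v_max: "w \<le> v" if "w \<in> K" "odd w" for w
      unfolding v_def using K(1) that by (intro Max_ge) auto
    obtain S i where S: "finite S" "v = ext S i" using v by (cases v rule: vertex_cases) auto
    \<comment> \<open>An edge not recorded at v would be recorded at w; then w is odd, hence at most
      v, contradicting \<open>odd_not_in_lower\<close>.\<close>
    have "w \<in> lower n G v" if "w \<in> K" "w \<noteq> v" for w
    proof (rule ccontr)
      assume "w \<notin> lower n G v"
      then have "v \<in> lower n G w" using K(3) v(1) that by (auto simp: adj_def)
      moreover from this have "odd w"
        using v(2) by (cases w rule: vertex_cases) (auto simp: lower_base)
      ultimately show False using odd_not_in_lower v(2) v_max that(1) by blast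
    qed
    then have "K - {v} \<subseteq> lower n G v" by auto
    moreover have "card (K - {v}) = n - 1" using K v(1) by simp
    moreover have "\<forall>x\<in>K - {v}. \<forall>y\<in>K - {v}. x \<noteq> y \<longrightarrow> adj n G x y" using K(3) by blast
    moreover have "clique_free (n - 1) (lower n G v) (adj n G)"
    proof (cases "clique_free (n - 1) S (adj n G)")
      case False
      \<comment> \<open>Here \<open>lower\<close> is empty, and the empty set avoids cliques of size
        n - 1 only if n > 1. The case n = 1 is excluded because G has a vertex.\<close>
      obtain k where k: "n = Suc k" using assms(3) by (cases n) auto
      have "k \<noteq> 0"
      proof
        assume "k = 0"
        then have "\<exists>K\<subseteq>UNIV. finite K \<and> card K = n \<and> (\<forall>x\<in>K. \<forall>y\<in>K. x \<noteq> y \<longrightarrow> G x y)"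
          using k by (intro exI[of _ "{0}"]) simp
        then show False using assms(2) by (simp add: clique_free_def)
      qed
      then show ?thesis
        using False S k by (auto simp: lower_ext clique_free_def)
    qed (use S in \<open>simp add: lower_ext\<close>)
    ultimately show False using K(1) unfolding clique_free_def by blast
  next
    case False
    define L where "L = (\<lambda>v. v div 2) ` K"
    have ev: "base (v div 2) = v" if "v \<in> K" for v using False that by (auto simp: base_def)
    then have "inj_on (\<lambda>v. v div 2) K" by (intro inj_on_inverseI[of _ base])
    then have "card L = n" using K(2) by (simp add: L_def card_image)
    moreover have "G a b" if ab: "a \<in> L" "b \<in> L" "a \<noteq> b" for a b
    proof -
      have "base a \<in> K" "base b \<in> K" using ab(1,2) ev by (auto simp: L_def)
      then have "adj n G (base a) (base b)" using K(3) ab(3) base_simps(3) by blast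
      then show ?thesis using adj_base[OF sym] by blast
    qed
    moreover have "finite L" using K(1) by (simp add: L_def)
    ultimately show False using assms(2) unfolding clique_free_def by blast
  qed
qed

lemma clique_free_extension_adj: "clique_free_extension n (adj n G)"
  unfolding clique_free_extension_def
proof (intro allI impI)
  fix A S :: "nat set"
  assume A: "finite A" "S \<subseteq> A" and S: "clique_free (n - 1) S (adj n G)"
  have fin: "finite S" using A finite_subset by blast
  \<comment> \<open>A bound of A used as index puts \<open>ext S i\<close> above all of A, so its
    own \<open>lower\<close> set alone decides its edges into A.\<close>
  obtain i where i: "\<forall>y\<in>A. y \<le> i" using A(1) finite_nat_set_iff_bounded_le by blast
  define x where "x = ext S i"
  have x: "odd x" "\<forall>y\<in>A. y < x"
    using i index_less_ext[of i S] by (auto simp: x_def)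
  then have "x \<notin> lower n G y" if "y \<in> A" for y
    using that by (intro odd_not_in_lower) auto
  moreover have "lower n G x = S" using S fin by (simp add: x_def lower_ext)
  ultimately have "\<forall>y\<in>A. adj n G x y \<longleftrightarrow> y \<in> S" by (auto simp: adj_def)
  moreover have "x \<notin> A" using x(2) by blast
  ultimately show "\<exists>x. x \<notin> A \<and> (\<forall>y\<in>A. adj n G x y \<longleftrightarrow> y \<in> S)" by blast
qed

section \<open>Lifted isomorphisms and the coding automorphism\<close>

function lift :: "(nat \<Rightarrow> nat) \<Rightarrow> (nat \<Rightarrow> nat) \<Rightarrow> nat \<Rightarrow> nat" where
  "lift g h v = (if even v then base (g (v div 2)) else ext (lift g h ` members v) (h (index v)))"
  by pat_completeness auto
termination
  by (relation "Wellfounded.measure (\<lambda>(g, h, v). v)") (auto simp: members_less)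

declare lift.simps [simp del]

lemma lift_base [simp]: "lift g h (base a) = base (g a)"
  by (subst lift.simps) simp

lemma lift_ext: "finite S \<Longrightarrow> lift g h (ext S i) = ext (lift g h ` S) (h i)"
  by (subst lift.simps) simp

text \<open>Functoriality in both parameters. It yields inverses of lifts, and the commutation of
  \<open>lift g id\<close> with \<open>shift\<close>, since g and h act on separate data.\<close>

lemma lift_comp: "lift g h (lift g' h' v) = lift (g \<circ> g') (h \<circ> h') v"
proof (induction v rule: less_induct)
  case (less v)
  show ?case
  proof (cases v rule: vertex_cases)
    case (ext S i)
    then have eq: "(\<lambda>x. lift g h (lift g' h' x)) ` S = lift (g \<circ> g') (h \<circ> h') ` S"
      using less.IH ext mem_less_ext by (intro image_cong) blast+
    have "lift g h (lift g' h' v) = ext ((\<lambda>x. lift g h (lift g' h' x)) ` S) (h (h' i))"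
      using ext by (simp add: lift_ext image_image)
    also have "\<dots> = lift (g \<circ> g') (h \<circ> h') v"
      unfolding eq ext(2) lift_ext[OF ext(1)] o_apply[of h] by (rule refl)
    finally show ?thesis .
  qed simp
qed

lemma lift_id: "lift id id v = v"
proof (induction v rule: less_induct)
  case (less v)
  show ?case
  proof (cases v rule: vertex_cases)
    case (ext S i)
    then have eq: "lift id id ` S = S"
      using less.IH ext mem_less_ext by (metis image_cong image_ident)
    show ?thesis unfolding ext(2) lift_ext[OF ext(1)] eq by simp
  qed simp
qed

lemma bij_lift:
  assumes "bij g" "bij h"
  shows "bij (lift g h)"
proof (rule o_bij)
  show "lift (inv g) (inv h) \<circ> lift g h = id" "lift g h \<circ> lift (inv g) (inv h) = id"
    using assms by (auto simp: lift_comp lift_id bij_def inj_iff surj_iff)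
qed

text \<open>Whether \<open>ext S i\<close> is joined to S depends only on edges within S, and these
  are recorded at vertices below \<open>ext S i\<close>. Hence strong induction on v, for all w at
  once.\<close>

lemma lift_in_lower:
  assumes g: "graph_iso g UNIV G UNIV H" and h: "bij h"
  shows "lift g h w \<in> lower n H (lift g h v) \<longleftrightarrow> w \<in> lower n G v"
proof (induction v arbitrary: w rule: less_induct)
  case (less v)
  have gb: "bij g" and GH: "G a b \<longleftrightarrow> H (g a) (g b)" for a b
    using g by (auto simp: graph_iso_def)
  have inj: "inj (lift g h)" using bij_lift[OF gb h] by (simp add: bij_is_inj)
  show ?case
  proof (cases v rule: vertex_cases)
    case (base a)
    then show ?thesis
    proof (cases w rule: vertex_cases)
      case (base b)
      then show ?thesis using \<open>v = base a\<close> GH by (auto simp: lower_base)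
    next
      case (ext S i)
      then show ?thesis using \<open>v = base a\<close> by (auto simp: lower_base lift_ext)
    qed
  next
    case (ext S i)
    have "adj n H (lift g h x) (lift g h y) \<longleftrightarrow> adj n G x y" if "x \<in> S" "y \<in> S" for x y
      using less ext that mem_less_ext by (simp add: adj_def)
    then have "graph_iso (lift g h) S (adj n G) (lift g h ` S) (adj n H)"
      using inj_on_subset[OF inj] by (simp add: graph_iso_def bij_betw_def)
    then have "clique_free (n - 1) (lift g h ` S) (adj n H) \<longleftrightarrow> clique_free (n - 1) S (adj n G)"
      using clique_free_graph_iso by blast
    then show ?thesis
      using ext inj by (simp add: lift_ext lower_ext inj_image_mem_iff)
  qed
qed

lemma graph_iso_lift:
  assumes "graph_iso g UNIV G UNIV H" "bij h"
  shows "graph_iso (lift g h) UNIV (adj n G) UNIV (adj n H)"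
  using assms bij_lift lift_in_lower[OF assms] by (auto simp: graph_iso_def adj_def)

definition swap_parity :: "nat \<Rightarrow> nat" where
  "swap_parity i = (if even i then Suc i else i - 1)"

lemma bij_swap_parity: "bij swap_parity"
proof -
  have "swap_parity (swap_parity i) = i" for i by (auto simp: swap_parity_def)
  then show ?thesis by (metis involuntory_imp_bij)
qed

lemma swap_parity_neq: "swap_parity i \<noteq> i"
  by (auto simp: swap_parity_def) presburger

definition shift :: "nat \<Rightarrow> nat" where "shift = lift id swap_parity"

text \<open>The outermost index alone moves an odd vertex, whatever happens to its members.\<close>

lemma shift_fixed_iff: "shift v = v \<longleftrightarrow> even v"
proof (cases v rule: vertex_cases)
  case (ext S i)
  then show ?thesis using swap_parity_neq by (simp add: shift_def lift_ext ext_inject)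
qed (simp add: shift_def)

lemma graph_iso_shift: "graph_iso shift UNIV (adj n G) UNIV (adj n G)"
  unfolding shift_def by (rule graph_iso_lift[OF _ bij_swap_parity]) (simp add: graph_iso_def)

section \<open>Borel dependence on the base graph\<close>

lemma pred_lower:
  assumes G: "\<And>a b. Measurable.pred M (\<lambda>x. G x a b)"
  shows "Measurable.pred M (\<lambda>x. w \<in> lower n (G x) v)"
proof (induction v arbitrary: w rule: less_induct)
  case (less v)
  show ?case
  proof (cases v rule: vertex_cases)
    case (base a)
    show ?thesis
    proof (cases w rule: vertex_cases)
      case (base b)
      then show ?thesis using G \<open>v = base a\<close> by (simp add: lower_base image_iff)
    next
      case (ext S i)
      then show ?thesis using \<open>v = base a\<close> by (simp add: lower_base image_iff)
    qed
  next
    case (ext S i)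
    then have fin: "finite S" by simp
    have pred_adj: "Measurable.pred M (\<lambda>x. adj n (G x) u u')" if "u \<in> S" "u' \<in> S" for u u'
      unfolding adj_def using less ext that mem_less_ext
      by (intro pred_intros_logic) auto
    \<comment> \<open>All quantifiers now range over finite sets, so the condition is a finite
      Boolean combination of edges, measurable by induction.\<close>
    have eq: "clique_free (n - 1) S (adj n (G x)) \<longleftrightarrow>
        (\<forall>K\<in>Pow S. card K = n - 1 \<longrightarrow> \<not> (\<forall>u\<in>K. \<forall>u'\<in>K. u \<noteq> u' \<longrightarrow> adj n (G x) u u'))" for x
      using fin finite_subset unfolding clique_free_def by blast
    have pred_clique: "Measurable.pred M (\<lambda>x. \<forall>u\<in>K. \<forall>u'\<in>K. u \<noteq> u' \<longrightarrow> adj n (G x) u u')"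
      if "K \<in> Pow S" for K
    proof -
      have "finite K" "K \<subseteq> S" using that fin finite_subset by auto
      then show ?thesis
        by (intro pred_intros_finite pred_intros_logic pred_adj) auto
    qed
    have "Measurable.pred M (\<lambda>x. \<forall>K\<in>Pow S. card K = n - 1 \<longrightarrow>
        \<not> (\<forall>u\<in>K. \<forall>u'\<in>K. u \<noteq> u' \<longrightarrow> adj n (G x) u u'))"
      by (rule pred_intros_finite(3), simp add: fin)
        (rule pred_intros_logic(4), simp, rule pred_intros_logic(2), erule pred_clique)
    then have "Measurable.pred M (\<lambda>x. clique_free (n - 1) S (adj n (G x)))" unfolding eq .
    then show ?thesis using ext by (simp add: lower_ext if_distrib[of "\<lambda>A. w \<in> A"])
  qed
qed

lemma pred_adj:
  assumes "\<And>a b. Measurable.pred M (\<lambda>x. G x a b)"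
  shows "Measurable.pred M (\<lambda>x. adj n (G x) v w)"
  unfolding adj_def using pred_lower[OF assms] by (intro pred_intros_logic)

section \<open>Back and forth\<close>

text \<open>Finite partial isomorphisms are lists of pairs because these form a countable type: a
  stage of the construction is then a measurable map into a discrete space.\<close>

definition partial_iso :: "('a \<Rightarrow> 'a \<Rightarrow> bool) \<Rightarrow> ('b \<Rightarrow> 'b \<Rightarrow> bool) \<Rightarrow> ('a \<times> 'b) list \<Rightarrow> bool" where
  "partial_iso E F p \<longleftrightarrow>
     (\<forall>a b c d. (a, b) \<in> set p \<longrightarrow> (c, d) \<in> set p \<longrightarrow>
        (a = c \<longleftrightarrow> b = d) \<and> (E a c \<longleftrightarrow> F b d))"

definition compatible ::
  "('a \<Rightarrow> 'a \<Rightarrow> bool) \<Rightarrow> ('b \<Rightarrow> 'b \<Rightarrow> bool) \<Rightarrow> ('a \<times> 'b) list \<Rightarrow> 'a \<Rightarrow> 'b \<Rightarrow> bool" where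
  "compatible E F p a b \<longleftrightarrow> b \<notin> snd ` set p \<and> (\<forall>q\<in>set p. E a (fst q) \<longleftrightarrow> F b (snd q))"

text \<open>The least admissible image, unlike an arbitrary choice, is a Borel function of the two
  graphs.\<close>

definition forth ::
  "('a \<Rightarrow> 'a \<Rightarrow> bool) \<Rightarrow> (nat \<Rightarrow> nat \<Rightarrow> bool) \<Rightarrow> 'a \<Rightarrow> ('a \<times> nat) list \<Rightarrow> ('a \<times> nat) list" where
  "forth E F a p =
     (if a \<in> fst ` set p then p else (a, LEAST b. compatible E F p a b) # p)"

text \<open>The back step is \<open>forth\<close> with the two graphs exchanged; stage k puts k into
  both domain and range.\<close>

primrec back_and_forth ::
  "(nat \<Rightarrow> nat \<Rightarrow> bool) \<Rightarrow> (nat \<Rightarrow> nat \<Rightarrow> bool) \<Rightarrow> nat \<Rightarrow> (nat \<times> nat) list" where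
  "back_and_forth E F 0 = []"
| "back_and_forth E F (Suc k) =
     map prod.swap (forth F E k (map prod.swap (forth E F k (back_and_forth E F k))))"

text \<open>Stage \<open>Suc a\<close> already has a in its domain and later stages only extend it,
  so this one stage determines the value.\<close>

definition limit_iso :: "(nat \<Rightarrow> nat \<Rightarrow> bool) \<Rightarrow> (nat \<Rightarrow> nat \<Rightarrow> bool) \<Rightarrow> nat \<Rightarrow> nat" where
  "limit_iso E F a = the (map_of (back_and_forth E F (Suc a)) a)"

lemma partial_isoD:
  assumes "partial_iso E F p" "(a, b) \<in> set p" "(c, d) \<in> set p"
  shows "a = c \<longleftrightarrow> b = d" "E a c \<longleftrightarrow> F b d"
  using assms unfolding partial_iso_def by blast+

lemma partial_iso_swap:
  "partial_iso F E (map prod.swap p) \<longleftrightarrow> partial_iso E F p"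
  by (auto simp: partial_iso_def)

lemma forth_extends: "set p \<subseteq> set (forth E F a p)" "a \<in> fst ` set (forth E F a p)"
  by (auto simp: forth_def)

text \<open>The inverse of p turns the neighbourhood S required of b into a set of neighbours of a.
  Hence S contains no K_{n-1}, and the extension property of F applies.\<close>

lemma ex_compatible:
  assumes E: "simple_graph UNIV E" "clique_free n UNIV E" "n \<ge> 1"
    and F: "clique_free_extension n F" and p: "partial_iso E F p"
  shows "\<exists>b. compatible E F p a b"
proof -
  define S where "S = {d. \<exists>c. (c, d) \<in> set p \<and> E a c}"
  define g where "g d = (SOME c. (c, d) \<in> set p \<and> E a c)" for d
  have g: "(g d, d) \<in> set p \<and> E a (g d)" if "d \<in> S" for d
    unfolding g_def by (rule someI_ex) (use that in \<open>simp add: S_def\<close>)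
  have g_iso: "g d = g d' \<longleftrightarrow> d = d'" "F d d' \<longleftrightarrow> E (g d) (g d')" if "d \<in> S" "d' \<in> S" for d d'
    using partial_isoD[OF p, of "g d" d "g d'" d'] g that by simp_all
  then have "inj_on g S" by (simp add: inj_on_def)
  with g_iso have "graph_iso g S F (g ` S) E" by (simp add: graph_iso_def bij_betw_def)
  moreover have "clique_free (n - 1) (g ` S) E"
    by (rule clique_free_subset[OF clique_free_neighbours[OF E, of a]]) (use g in auto)
  ultimately have "clique_free (n - 1) S F" by (rule clique_free_embedding)
  moreover have "finite (snd ` set p)" "S \<subseteq> snd ` set p" by (force simp: S_def)+
  ultimately obtain b where b: "b \<notin> snd ` set p" "\<forall>d\<in>snd ` set p. F b d \<longleftrightarrow> d \<in> S"
    using F unfolding clique_free_extension_def by blast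
  have "E a c \<longleftrightarrow> F b d" if "(c, d) \<in> set p" for c d
  proof -
    have "d \<in> S \<longleftrightarrow> E a c"
      using that partial_isoD(1)[OF p] by (auto simp: S_def)
    moreover have "d \<in> snd ` set p" using that by force
    ultimately show ?thesis using b(2) by blast
  qed
  then have "compatible E F p a b" using b(1) by (auto simp: compatible_def)
  then show ?thesis by blast
qed

lemma partial_iso_forth:
  assumes E: "simple_graph UNIV E" "clique_free n UNIV E" "n \<ge> 1"
    and F: "simple_graph UNIV F" "clique_free_extension n F" and p: "partial_iso E F p"
  shows "partial_iso E F (forth E F a p)"
proof (cases "a \<in> fst ` set p")
  case False
  define b where "b = (LEAST b. compatible E F p a b)"
  have b: "compatible E F p a b"
    unfolding b_def using ex_compatible[OF E F(2) p] by (rule LeastI_ex)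
  have sym: "symp E" "symp F" and irrefl: "\<not> E a a" "\<not> F b b"
    using E(1) F(1) by (auto simp: simple_graph_def irreflp_on_def)
  have new: "a \<noteq> c" "b \<noteq> d" "E a c \<longleftrightarrow> F b d" "E c a \<longleftrightarrow> F d b" if "(c, d) \<in> set p" for c d
  proof -
    show "a \<noteq> c" "b \<noteq> d" "E a c \<longleftrightarrow> F b d"
      using that False b by (force simp: compatible_def)+
    then show "E c a \<longleftrightarrow> F d b" using sym by (metis sympD)
  qed
  have "(u = w \<longleftrightarrow> v = z) \<and> (E u w \<longleftrightarrow> F v z)"
    if uv: "(u, v) \<in> set ((a, b) # p)" and wz: "(w, z) \<in> set ((a, b) # p)" for u v w z
  proof -
    consider "u = a" "v = b" "w = a" "z = b" | "u = a" "v = b" "(w, z) \<in> set p"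
      | "(u, v) \<in> set p" "w = a" "z = b" | "(u, v) \<in> set p" "(w, z) \<in> set p"
      using uv wz by auto
    then show ?thesis
      by cases (use irrefl new[of w z] new[of u v] partial_isoD[OF p, of u v w z] in auto)
  qed
  then have "partial_iso E F ((a, b) # p)" unfolding partial_iso_def by blast
  then show ?thesis using False by (simp add: forth_def b_def)
qed (use p in \<open>simp add: forth_def\<close>)

lemma back_and_forth_mono:
  assumes "j \<le> k"
  shows "set (back_and_forth E F j) \<subseteq> set (back_and_forth E F k)"
  using assms
proof (rule lift_Suc_mono_le[of "\<lambda>k. set (back_and_forth E F k)", rotated])
  fix k
  let ?p = "forth E F k (back_and_forth E F k)"
  have "set (back_and_forth E F k) \<subseteq> set ?p" by (rule forth_extends)
  also have "\<dots> = prod.swap ` set (map prod.swap ?p)" by (simp add: image_image)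
  also have "\<dots> \<subseteq> set (back_and_forth E F (Suc k))"
    using forth_extends(1)[of "map prod.swap ?p" F E k] by auto
  finally show "set (back_and_forth E F k) \<subseteq> set (back_and_forth E F (Suc k))" .
qed

lemma back_and_forth_total:
  "a \<in> fst ` set (back_and_forth E F (Suc a))" "a \<in> snd ` set (back_and_forth E F (Suc a))"
proof -
  let ?p = "map prod.swap (forth E F a (back_and_forth E F a))"
  have eq: "back_and_forth E F (Suc a) = map prod.swap (forth F E a ?p)" by simp
  have "a \<in> snd ` set ?p"
    using forth_extends(2)[of a E F "back_and_forth E F a"] by (force simp: image_image)
  then show "a \<in> fst ` set (back_and_forth E F (Suc a))"
    unfolding eq using forth_extends(1)[of ?p F E a] by (force simp: image_image)
  show "a \<in> snd ` set (back_and_forth E F (Suc a))"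
    unfolding eq using forth_extends(2)[of a F E ?p] by (simp add: image_image)
qed

lemma graph_iso_limit_iso:
  assumes E: "simple_graph UNIV E" "clique_free n UNIV E" "clique_free_extension n E"
    and F: "simple_graph UNIV F" "clique_free n UNIV F" "clique_free_extension n F"
    and n: "n \<ge> 1"
  shows "graph_iso (limit_iso E F) UNIV E UNIV F"
proof -
  let ?h = "limit_iso E F" and ?p = "back_and_forth E F"
  have iso: "partial_iso E F (?p k)" for k
  proof (induction k)
    case (Suc k)
    then have "partial_iso E F (forth E F k (?p k))"
      by (intro partial_iso_forth[OF E(1,2) n F(1,3)])
    then have "partial_iso F E (forth F E k (map prod.swap (forth E F k (?p k))))"
      by (intro partial_iso_forth[OF F(1,2) n E(1,3)]) (simp add: partial_iso_swap)
    then show ?case by (simp add: partial_iso_swap)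
  qed (simp add: partial_iso_def)
  \<comment> \<open>Stages increase, so pairs from different stages can be compared in the later
    one.\<close>
  have iso2: "(a = c \<longleftrightarrow> b = d) \<and> (E a c \<longleftrightarrow> F b d)"
    if "(a, b) \<in> set (?p j)" "(c, d) \<in> set (?p k)" for a b c d j k
  proof -
    have "(a, b) \<in> set (?p (max j k))" "(c, d) \<in> set (?p (max j k))"
      using that back_and_forth_mono[of j "max j k" E F] back_and_forth_mono[of k "max j k" E F]
      by auto
    then show ?thesis using partial_isoD[OF iso[of "max j k"]] by simp
  qed
  have h: "(a, ?h a) \<in> set (?p (Suc a))" for a
  proof -
    have "map_of (?p (Suc a)) a \<noteq> None"
      using back_and_forth_total(1) by (simp only: map_of_eq_None_iff not_not)
    then show ?thesis unfolding limit_iso_def by (intro map_of_SomeD) auto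
  qed
  have "inj ?h" using iso2[OF h h] by (intro injI) blast
  moreover have "\<exists>a. ?h a = b" for b
  proof -
    obtain a where "(a, b) \<in> set (?p (Suc b))" using back_and_forth_total(2) by fastforce
    then show ?thesis using iso2[OF h] by blast
  qed
  ultimately have "bij ?h" by (metis bijI surj_def)
  then show ?thesis using iso2[OF h h] by (simp add: graph_iso_def)
qed

section \<open>Measurability of the back and forth\<close>

lemma measurable_forth:
  fixes E :: "'m \<Rightarrow> nat \<Rightarrow> nat \<Rightarrow> bool"
  assumes [measurable]: "\<And>a b. Measurable.pred M (\<lambda>x. E x a b)" "\<And>a b. Measurable.pred M (\<lambda>x. F x a b)"
    and p: "p \<in> M \<rightarrow>\<^sub>M count_space UNIV"
  shows "(\<lambda>x. forth (E x) (F x) a (p x)) \<in> M \<rightarrow>\<^sub>M count_space UNIV"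
\<comment> \<open>The previous stage takes countably many values, so it may be fixed as q;
  compatibility with q is a finite condition on edges.\<close>
proof (rule measurable_compose_countable[OF _ p])
  fix q :: "(nat \<times> nat) list"
  have [measurable]: "Measurable.pred M (\<lambda>x. compatible (E x) (F x) q a b)" for b
    unfolding compatible_def by measurable
  have "(\<lambda>x. (a, LEAST b. compatible (E x) (F x) q a b) # q) \<in> M \<rightarrow>\<^sub>M count_space UNIV"
    by (rule measurable_compose[where f = "\<lambda>x. LEAST b. compatible (E x) (F x) q a b"
          and g = "\<lambda>b. (a, b) # q"]) measurable
  then show "(\<lambda>x. forth (E x) (F x) a q) \<in> M \<rightarrow>\<^sub>M count_space UNIV"
    by (simp add: forth_def)
qed

lemma measurable_limit_iso:
  assumes "\<And>a b. Measurable.pred M (\<lambda>x. E x a b)" "\<And>a b. Measurable.pred M (\<lambda>x. F x a b)"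
  shows "(\<lambda>x. limit_iso (E x) (F x) a) \<in> M \<rightarrow>\<^sub>M count_space UNIV"
proof -
  have swap: "(\<lambda>x. map prod.swap (p x)) \<in> M \<rightarrow>\<^sub>M count_space UNIV"
    if "p \<in> M \<rightarrow>\<^sub>M count_space UNIV" for p :: "_ \<Rightarrow> (nat \<times> nat) list"
    using that by (rule measurable_compose) simp
  have "(\<lambda>x. back_and_forth (E x) (F x) k) \<in> M \<rightarrow>\<^sub>M count_space UNIV" for k
  proof (induction k)
    case (Suc k)
    then show ?case
      by (simp only: back_and_forth.simps) (intro swap measurable_forth assms)
  qed simp
  then show ?thesis unfolding limit_iso_def by (rule measurable_compose) simp
qed

section \<open>Conjugacy\<close>

lemma conjugation_iff:
  assumes "bij \<delta>"
  shows "\<psi> = \<delta> \<circ> \<phi> \<circ> inv \<delta> \<longleftrightarrow> \<psi> \<circ> \<delta> = \<delta> \<circ> \<phi>"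
proof
  assume "\<psi> \<circ> \<delta> = \<delta> \<circ> \<phi>"
  then have "\<psi> \<circ> (\<delta> \<circ> inv \<delta>) = \<delta> \<circ> \<phi> \<circ> inv \<delta>" by (metis comp_assoc)
  then show "\<psi> = \<delta> \<circ> \<phi> \<circ> inv \<delta>" using assms by (simp add: bij_def surj_iff)
qed (use assms in \<open>simp add: bij_def inj_iff comp_assoc\<close>)

text \<open>Conjugators \<open>\<delta>\<close> correspond to intertwining isomorphisms
  \<open>\<alpha>\<close> by \<open>\<alpha> = inv h' \<circ> \<delta> \<circ> h\<close>. So
  conjugacy of the transported maps does not depend on how h and h' were chosen.\<close>

lemma conjugate_transported_iff:
  assumes h: "graph_iso h UNIV E UNIV \<Gamma>" and h': "graph_iso h' UNIV E' UNIV \<Gamma>"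
  shows "conjugate_in (aut \<Gamma>) (h \<circ> \<phi> \<circ> inv h) (h' \<circ> \<phi>' \<circ> inv h') \<longleftrightarrow>
    (\<exists>\<alpha>. graph_iso \<alpha> UNIV E UNIV E' \<and> \<phi>' \<circ> \<alpha> = \<alpha> \<circ> \<phi>)"
proof -
  have inv: "inv h \<circ> h = id" "h \<circ> inv h = id" "inv h' \<circ> h' = id" "h' \<circ> inv h' = id"
    using h h' by (simp_all add: graph_iso_def bij_def inj_iff surj_iff)
  note inv_pointwise = inv[unfolded fun_eq_iff, simplified]
  show ?thesis
  proof
    assume "conjugate_in (aut \<Gamma>) (h \<circ> \<phi> \<circ> inv h) (h' \<circ> \<phi>' \<circ> inv h')"
    then obtain \<delta> where \<delta>: "graph_iso \<delta> UNIV \<Gamma> UNIV \<Gamma>"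
      and eq: "h' \<circ> \<phi>' \<circ> inv h' \<circ> \<delta> = \<delta> \<circ> (h \<circ> \<phi> \<circ> inv h)"
      using conjugation_iff unfolding conjugate_in_def aut_def graph_iso_def by blast
    have "graph_iso (inv h' \<circ> (\<delta> \<circ> h)) UNIV E UNIV E'"
      by (rule graph_iso_comp[OF graph_iso_comp[OF h \<delta>] graph_iso_inv[OF h']])
    moreover have "\<phi>' (inv h' (\<delta> (h x))) = inv h' (\<delta> (h (\<phi> x)))" for x
      using fun_cong[OF eq, of "h x"] inv_pointwise by (metis o_apply)
    then have "\<phi>' \<circ> (inv h' \<circ> (\<delta> \<circ> h)) = inv h' \<circ> (\<delta> \<circ> h) \<circ> \<phi>" by auto
    ultimately show "\<exists>\<alpha>. graph_iso \<alpha> UNIV E UNIV E' \<and> \<phi>' \<circ> \<alpha> = \<alpha> \<circ> \<phi>" by blast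
  next
    assume "\<exists>\<alpha>. graph_iso \<alpha> UNIV E UNIV E' \<and> \<phi>' \<circ> \<alpha> = \<alpha> \<circ> \<phi>"
    then obtain \<alpha> where \<alpha>: "graph_iso \<alpha> UNIV E UNIV E'" and eq: "\<phi>' \<circ> \<alpha> = \<alpha> \<circ> \<phi>" by blast
    let ?\<delta> = "h' \<circ> (\<alpha> \<circ> inv h)"
    have "graph_iso ?\<delta> UNIV \<Gamma> UNIV \<Gamma>"
      by (rule graph_iso_comp[OF graph_iso_comp[OF graph_iso_inv[OF h] \<alpha>] h'])
    moreover have "h' \<circ> \<phi>' \<circ> inv h' \<circ> ?\<delta> = ?\<delta> \<circ> (h \<circ> \<phi> \<circ> inv h)"
      using fun_cong[OF eq] inv_pointwise by (simp add: fun_eq_iff)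
    ultimately show "conjugate_in (aut \<Gamma>) (h \<circ> \<phi> \<circ> inv h) (h' \<circ> \<phi>' \<circ> inv h')"
      using conjugation_iff unfolding conjugate_in_def aut_def graph_iso_def by blast
  qed
qed

text \<open>A bijection commuting with \<open>shift\<close> preserves its fixed points, which are
  the base vertices, and so restricts to an isomorphism of the base graphs. In the converse
  direction the witness is \<open>lift g id\<close>.\<close>

lemma ex_graph_iso_adj_shift_iff:
  assumes "symp G" "symp H"
  shows "(\<exists>\<alpha>. graph_iso \<alpha> UNIV (adj n G) UNIV (adj n H) \<and> shift \<circ> \<alpha> = \<alpha> \<circ> shift)
    \<longleftrightarrow> graph_isomorphic G H"
proof
  assume "\<exists>\<alpha>. graph_iso \<alpha> UNIV (adj n G) UNIV (adj n H) \<and> shift \<circ> \<alpha> = \<alpha> \<circ> shift"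
  then obtain \<alpha> where \<alpha>: "bij \<alpha>" "\<And>x y. adj n G x y \<longleftrightarrow> adj n H (\<alpha> x) (\<alpha> y)"
    and comm: "shift \<circ> \<alpha> = \<alpha> \<circ> shift"
    by (auto simp: graph_iso_def)
  have even: "even (\<alpha> v) \<longleftrightarrow> even v" for v
    using fun_cong[OF comm, of v] bij_is_inj[OF \<alpha>(1)]
    by (simp add: inj_eq flip: shift_fixed_iff)
  define g where "g a = \<alpha> (base a) div 2" for a
  have base_g: "base (g a) = \<alpha> (base a)" for a
    using even[of "base a"] by (simp add: g_def base_def)
  have "inj g"
    using base_g bij_is_inj[OF \<alpha>(1)] base_simps(3) by (metis inj_def)
  moreover have "\<exists>a. g a = b" for b
  proof -
    obtain v where v: "\<alpha> v = base b" using bij_pointE[OF \<alpha>(1)] by metis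
    then have "even v" using even by (metis base_simps(1))
    then have "v = base (v div 2)" by (simp add: base_def)
    then show ?thesis using v base_g base_simps(3) by metis
  qed
  ultimately have "bij g" by (metis bijI surj_def)
  moreover have "G a b \<longleftrightarrow> H (g a) (g b)" for a b
    using \<alpha>(2)[of "base a" "base b"] assms by (simp add: adj_base flip: base_g)
  ultimately show "graph_isomorphic G H"
    by (auto simp: graph_isomorphic_def graph_iso_def)
next
  assume "graph_isomorphic G H"
  then obtain g where "graph_iso g UNIV G UNIV H" by (auto simp: graph_isomorphic_def)
  then have "graph_iso (lift g id) UNIV (adj n G) UNIV (adj n H)" by (rule graph_iso_lift) simp
  moreover have "shift \<circ> lift g id = lift g id \<circ> shift"
    by (simp add: fun_eq_iff shift_def lift_comp)
  ultimately show "\<exists>\<alpha>. graph_iso \<alpha> UNIV (adj n G) UNIV (adj n H) \<and> shift \<circ> \<alpha> = \<alpha> \<circ> shift"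
    by blast
qed

text \<open>The conjugate of \<open>shift\<close> by \<open>limit_iso\<close>. The inverse is
  written with \<open>LEAST\<close>, which is evidently measurable and agrees with it when
  \<open>limit_iso\<close> is a bijection.\<close>

definition coding_automorphism ::
  "nat \<Rightarrow> (nat \<Rightarrow> nat \<Rightarrow> bool) \<Rightarrow> (nat \<Rightarrow> nat \<Rightarrow> bool) \<Rightarrow> nat \<Rightarrow> nat" where
  "coding_automorphism n \<Gamma> G b =
     limit_iso (adj n G) \<Gamma> (shift (LEAST a. limit_iso (adj n G) \<Gamma> a = b))"

lemma clique_free_graphs_reducible:
  assumes n: "n \<ge> 1" and \<Gamma>: "generic_clique_free n \<Gamma>"
  shows "borel_reducible (clique_free_graphs n) graph_isomorphic
    (aut_space \<Gamma>) (conjugate_in (aut \<Gamma>))"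
proof -
  let ?f = "coding_automorphism n \<Gamma>"
  let ?h = "\<lambda>G. limit_iso (adj n G) \<Gamma>"
  have simple: "simple_graph UNIV \<Gamma>" using \<Gamma> by (simp add: generic_clique_free_def)
  have space: "G \<in> space (clique_free_graphs n) \<longleftrightarrow> simple_graph UNIV G \<and> clique_free n UNIV G" for G
    by (simp add: clique_free_graphs_def space_restrict_space)
  have iso: "graph_iso (?h G) UNIV (adj n G) UNIV \<Gamma>" if "G \<in> space (clique_free_graphs n)" for G
    using that n \<Gamma> simple generic_clique_free_UNIV generic_clique_free_extension
    by (intro graph_iso_limit_iso[of _ n] simple_graph_adj clique_free_adj clique_free_extension_adj)
      (auto simp: space)
  have f: "?f G = ?h G \<circ> shift \<circ> inv (?h G)" if "G \<in> space (clique_free_graphs n)" for G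
  proof -
    have "bij (?h G)" using iso[OF that] by (simp add: graph_iso_def)
    then have "(LEAST a. ?h G a = b) = inv (?h G) b" for b
      by (intro Least_equality) (auto simp: bij_is_surj surj_f_inv_f bij_is_inj)
    then show ?thesis by (simp add: fun_eq_iff coding_automorphism_def)
  qed
  have "?f G \<in> aut \<Gamma>" if "G \<in> space (clique_free_graphs n)" for G
    using graph_iso_comp[OF graph_iso_inv[OF iso[OF that]]
        graph_iso_comp[OF graph_iso_shift iso[OF that]]]
    by (simp add: f[OF that] aut_def)
  moreover have "?f \<in> borel_measurable (clique_free_graphs n)"
  proof (rule measurable_coordinatewise_then_product)
    fix b
    have "Measurable.pred (clique_free_graphs n) (\<lambda>G. G a c)" for a c
      by (rule pred_borel_coordinate) (simp add: clique_free_graphs_def measurable_restrict_space1)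
    then have h [measurable]: "(\<lambda>G. ?h G a) \<in> clique_free_graphs n \<rightarrow>\<^sub>M count_space UNIV" for a
      by (intro measurable_limit_iso pred_adj) simp_all
    have least: "(\<lambda>G. LEAST a. ?h G a = b) \<in> clique_free_graphs n \<rightarrow>\<^sub>M count_space UNIV"
      by measurable
    have "(\<lambda>G. ?f G b) \<in> clique_free_graphs n \<rightarrow>\<^sub>M count_space UNIV"
      \<comment> \<open>The point of evaluation itself varies measurably with G, with countably many
        values.\<close>
      unfolding coding_automorphism_def by (rule measurable_compose_countable[OF h least])
    then show "(\<lambda>G. ?f G b) \<in> borel_measurable (clique_free_graphs n)"
      by (simp add: borel_measurable_countable_discrete)
  qed
  ultimately have "?f \<in> clique_free_graphs n \<rightarrow>\<^sub>M aut_space \<Gamma>"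
    unfolding aut_space_def by (intro measurable_restrict_space2) auto
  moreover have "graph_isomorphic G H \<longleftrightarrow> conjugate_in (aut \<Gamma>) (?f G) (?f H)"
    if "G \<in> space (clique_free_graphs n)" "H \<in> space (clique_free_graphs n)" for G H
    using that ex_graph_iso_adj_shift_iff[of G H n]
    by (simp add: f conjugate_transported_iff[OF iso iso] space simple_graph_def)
  ultimately show ?thesis unfolding borel_reducible_def by blast
qed

section \<open>Coding structures by graphs\<close>

text \<open>
  \<open>(v, 0)\<close> is the original vertex and \<open>(v, r)\<close> with \<open>r > c v\<close> is isolated padding. Requiring
  \<open>c v \<ge> 2\<close> ensures that original vertices are not themselves leaves.
\<close>

definition with_leaves ::
  "('v \<Rightarrow> nat) \<Rightarrow> ('v \<Rightarrow> 'v \<Rightarrow> bool) \<Rightarrow> 'v \<times> nat \<Rightarrow> 'v \<times> nat \<Rightarrow> bool" where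
  "with_leaves c E x y \<longleftrightarrow>
     snd x = 0 \<and> snd y = 0 \<and> E (fst x) (fst y) \<or>
     fst x = fst y \<and> snd x = 0 \<and> snd y \<in> {1..c (fst y)} \<or>
     fst x = fst y \<and> snd y = 0 \<and> snd x \<in> {1..c (fst x)}"

definition leaves :: "('v \<Rightarrow> 'v \<Rightarrow> bool) \<Rightarrow> 'v \<Rightarrow> 'v set" where
  "leaves E x = {y. E x y \<and> is_singleton {z. E y z}}"

lemma leaf_with_leaves_iff:
  assumes "\<And>v. c v \<ge> 2"
  shows "is_singleton {z. with_leaves c E y z} \<longleftrightarrow> snd y \<in> {1..c (fst y)}"
proof -
  let ?N = "{z. with_leaves c E y z}"
  obtain v s where y: "y = (v, s)" by (cases y)
  consider "s = 0" | "s \<in> {1..c v}" | "s > c v" by force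
  then show ?thesis
  proof cases
    case 1
    have "(v, 1) \<in> ?N" "(v, 2) \<in> ?N"
      using assms[of v] 1 by (auto simp: with_leaves_def y)
    then have "(v, 1) = (v, 2 :: nat)" if "is_singleton ?N"
      using that by (metis is_singletonE singletonD)
    then have "\<not> is_singleton ?N" by auto
    then show ?thesis using 1 y by simp
  next
    case 2
    then have "?N = {(v, 0)}" by (auto simp: with_leaves_def prod_eq_iff y)
    then show ?thesis using 2 y by simp
  next
    case 3
    then have "?N = {}" by (auto simp: with_leaves_def y)
    then have "\<not> is_singleton ?N" by (metis insert_not_empty is_singletonE)
    then show ?thesis using 3 y by simp
  qed
qed

lemma leaves_with_leaves:
  assumes "\<And>v. c v \<ge> 2"
  shows "leaves (with_leaves c E) (v, r) = (if r = 0 then {v} \<times> {1..c v} else {})"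
  unfolding leaves_def leaf_with_leaves_iff[where c = c, OF assms]
  by (auto simp: with_leaves_def)

lemma card_leaves_graph_iso:
  assumes "graph_iso f UNIV E UNIV F"
  shows "card (leaves F (f x)) = card (leaves E x)"
proof -
  have f: "bij f" "E x y \<longleftrightarrow> F (f x) (f y)" for x y using assms by (auto simp: graph_iso_def)
  have inj: "inj f" using f(1) by (rule bij_is_inj)
  have image: "{z'. P z'} = f ` {z. P (f z)}" for P
    using surj_image_vimage_eq[OF bij_is_surj[OF f(1)], of "Collect P"] by (simp add: vimage_def)
  have "is_singleton {z. F (f y) z} \<longleftrightarrow> is_singleton {z. E y z}" for y
    using inj by (subst image) (simp add: is_singleton_altdef card_image inj_on_subset flip: f(2))
  then have "leaves F (f x) = f ` leaves E x"
    unfolding leaves_def by (subst image) (simp flip: f(2))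
  then show ?thesis using inj by (simp add: card_image inj_on_subset)
qed

text \<open>The number of adjacent leaves is an isomorphism invariant, positive exactly at original
  vertices and equal to the colour there. Conversely \<open>map_prod g id\<close> matches leaves and
  padding by their numbers.\<close>

lemma graph_isomorphic_with_leaves_iff:
  assumes c: "\<And>v. c v \<ge> 2"
  shows "graph_isomorphic (with_leaves c E) (with_leaves c F) \<longleftrightarrow>
    (\<exists>g. graph_iso g UNIV E UNIV F \<and> c \<circ> g = c)"
proof
  assume "graph_isomorphic (with_leaves c E) (with_leaves c F)"
  then obtain \<alpha> where \<alpha>: "graph_iso \<alpha> UNIV (with_leaves c E) UNIV (with_leaves c F)"
    by (auto simp: graph_isomorphic_def)
  then have bij: "bij \<alpha>"
    and edge: "with_leaves c E x y \<longleftrightarrow> with_leaves c F (\<alpha> x) (\<alpha> y)" for x y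
    unfolding graph_iso_def by blast+
  have card: "(if snd (\<alpha> (v, r)) = 0 then c (fst (\<alpha> (v, r))) else 0) = (if r = 0 then c v else 0)" for v r
    using card_leaves_graph_iso[OF \<alpha>, of "(v, r)"]
      leaves_with_leaves[where c = c, OF c, of F "fst (\<alpha> (v, r))" "snd (\<alpha> (v, r))"]
      leaves_with_leaves[where c = c, OF c, of E v r]
    by (simp split: if_splits)
  define g where "g v = fst (\<alpha> (v, 0))" for v
  have \<alpha>_core: "\<alpha> (v, 0) = (g v, 0)" "c (g v) = c v" for v
    using card[of v 0] c[of v] by (auto simp: g_def prod_eq_iff split: if_splits)
  have "inj g"
  proof (rule injI)
    fix v w assume "g v = g w"
    then have "\<alpha> (v, 0) = \<alpha> (w, 0)" by (simp add: \<alpha>_core)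
    then show "v = w" using bij_is_inj[OF bij] by (simp add: inj_eq)
  qed
  moreover have "\<exists>v. g v = w" for w
  proof -
    obtain v r where vr: "\<alpha> (v, r) = (w, 0)" using bij_pointE[OF bij] by (metis surj_pair)
    then have "r = 0" using card[of v r] c[of w] by (auto split: if_splits)
    then show ?thesis using vr by (intro exI[of _ v]) (simp add: g_def)
  qed
  ultimately have "bij g" by (metis bijI surj_def)
  moreover have "E v w \<longleftrightarrow> F (g v) (g w)" for v w
    using edge[of "(v, 0)" "(w, 0)"] by (simp add: \<alpha>_core(1)) (simp add: with_leaves_def)
  ultimately show "\<exists>g. graph_iso g UNIV E UNIV F \<and> c \<circ> g = c"
    using \<alpha>_core(2) by (auto simp: graph_iso_def fun_eq_iff)
next
  assume "\<exists>g. graph_iso g UNIV E UNIV F \<and> c \<circ> g = c"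
  then obtain g where g: "bij g" "\<And>x y. E x y \<longleftrightarrow> F (g x) (g y)" "\<And>v. c (g v) = c v"
    by (auto simp: graph_iso_def fun_eq_iff)
  have "bij (map_prod g (id :: nat \<Rightarrow> nat))"
    using g(1) by (simp add: bij_def prod.inj_map map_prod_surj)
  moreover have "with_leaves c E x y \<longleftrightarrow> with_leaves c F (map_prod g id x) (map_prod g id y)" for x y
    using g(2,3) inj_eq[OF bij_is_inj[OF g(1)]]
    by (cases x; cases y) (simp add: with_leaves_def)
  ultimately show "graph_isomorphic (with_leaves c E) (with_leaves c F)"
    unfolding graph_isomorphic_def graph_iso_def by blast
qed

text \<open>A clique has at most one vertex on each of the two sides.\<close>

lemma bipartite_clique_free:
  fixes side :: "'v \<Rightarrow> bool"
  assumes "\<And>x y. E x y \<Longrightarrow> side x \<noteq> side y" "n \<ge> 3"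
  shows "clique_free n V E"
  unfolding clique_free_def
proof (rule notI, elim exE conjE)
  fix K assume K: "finite K" "card K = n" "\<forall>x\<in>K. \<forall>y\<in>K. x \<noteq> y \<longrightarrow> E x y"
  have "inj_on side K"
  proof (rule inj_onI)
    fix x y assume "x \<in> K" "y \<in> K" "side x = side y"
    then show "x = y" using K(3) assms(1)[of x y] by auto
  qed
  then have "card K \<le> card (UNIV :: bool set)" by (rule card_inj_on_le) auto
  then show False using K(2) assms(2) by simp
qed

section \<open>The coloured incidence graph of a structure\<close>

datatype vertex = Elem nat | Tup "nat list" | Pos "nat list" nat | Symb nat

instance vertex :: countable
  by countable_datatype

text \<open>All lists have their vertices, whatever the structure; M enters only through edges
  between tuples and symbols. Separate position vertices record the order and repetition of
  entries.\<close>

fun arc :: "struct \<Rightarrow> vertex \<Rightarrow> vertex \<Rightarrow> bool" where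
  "arc M (Tup xs) (Pos ys j) \<longleftrightarrow> xs = ys \<and> j < length ys"
| "arc M (Elem a) (Pos ys j) \<longleftrightarrow> j < length ys \<and> ys ! j = a"
| "arc M (Tup xs) (Symb i) \<longleftrightarrow> M i xs"
| "arc M _ _ \<longleftrightarrow> False"

definition incidence :: "struct \<Rightarrow> vertex \<Rightarrow> vertex \<Rightarrow> bool" where
  "incidence M x y \<longleftrightarrow> arc M x y \<or> arc M y x"

text \<open>Colours start at 2 as required of leaf numbers. Position colours are even and depend
  only on j, symbol colours are odd and distinct: a colour-preserving map keeps positions and fixes
  every symbol.\<close>

fun colour :: "vertex \<Rightarrow> nat" where
  "colour (Elem _) = 2"
| "colour (Tup _) = 3"
| "colour (Pos _ j) = 4 + 2 * j"
| "colour (Symb i) = 5 + 2 * i"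

fun left :: "vertex \<Rightarrow> bool" where
  "left (Elem _) \<longleftrightarrow> True"
| "left (Tup _) \<longleftrightarrow> True"
| "left _ \<longleftrightarrow> False"

fun map_vertex :: "(nat \<Rightarrow> nat) \<Rightarrow> vertex \<Rightarrow> vertex" where
  "map_vertex g (Elem a) = Elem (g a)"
| "map_vertex g (Tup xs) = Tup (map g xs)"
| "map_vertex g (Pos xs j) = Pos (map g xs) j"
| "map_vertex g (Symb i) = Symb i"

lemma colour_ge_2: "colour v \<ge> 2"
  by (cases v) auto

lemma incidence_left: "incidence M x y \<Longrightarrow> left x \<noteq> left y"
  by (cases x; cases y) (auto simp: incidence_def)

lemma colour_eq_iff:
  "colour v = 2 \<longleftrightarrow> (\<exists>a. v = Elem a)"
  "colour v = 3 \<longleftrightarrow> (\<exists>xs. v = Tup xs)"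
  "colour v = 4 + 2 * j \<longleftrightarrow> (\<exists>xs. v = Pos xs j)"
  "colour v = 5 + 2 * i \<longleftrightarrow> v = Symb i"
  by (cases v; simp; presburger)+

lemma bij_map_vertex:
  assumes "bij g"
  shows "bij (map_vertex g)"
proof (rule o_bij)
  have comp: "map_vertex g (map_vertex h v) = map_vertex (g \<circ> h) v" for g h v
    by (cases v) auto
  have "map_vertex id v = v" for v by (cases v) auto
  then show "map_vertex (inv g) \<circ> map_vertex g = id" "map_vertex g \<circ> map_vertex (inv g) = id"
    using assms by (auto simp: comp bij_def inj_iff surj_iff)
qed

lemma arc_map_vertex:
  assumes g: "bij g" and M: "\<And>i xs. M i xs \<longleftrightarrow> N i (map g xs)"
  shows "arc M x y \<longleftrightarrow> arc N (map_vertex g x) (map_vertex g y)"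
  using bij_is_inj[OF g] M
  by (cases x; cases y) (auto simp: inj_eq inj_map_eq_map)

text \<open>By colours, \<open>\<alpha>\<close> induces a map g on elements and a map t on tuples. A
  tuple is determined by its position vertices and their elements, which forces t to be
  \<open>map g\<close>.\<close>

lemma struct_isomorphic_iff_incidence:
  "struct_isomorphic M N \<longleftrightarrow>
    (\<exists>\<alpha>. graph_iso \<alpha> UNIV (incidence M) UNIV (incidence N) \<and> colour \<circ> \<alpha> = colour)"
proof
  assume "struct_isomorphic M N"
  then obtain g where g: "bij g" "\<And>i xs. M i xs \<longleftrightarrow> N i (map g xs)"
    by (auto simp: struct_isomorphic_def)
  have "colour (map_vertex g v) = colour v" for v by (cases v) auto
  then have "colour \<circ> map_vertex g = colour" by auto
  moreover have "graph_iso (map_vertex g) UNIV (incidence M) UNIV (incidence N)"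
    using bij_map_vertex[OF g(1)] arc_map_vertex[of g M N, OF g(1)] g(2) by (simp add: graph_iso_def incidence_def)
  ultimately show "\<exists>\<alpha>. graph_iso \<alpha> UNIV (incidence M) UNIV (incidence N) \<and> colour \<circ> \<alpha> = colour"
    by blast
next
  assume "\<exists>\<alpha>. graph_iso \<alpha> UNIV (incidence M) UNIV (incidence N) \<and> colour \<circ> \<alpha> = colour"
  then obtain \<alpha> where \<alpha>: "bij \<alpha>" "\<And>x y. incidence M x y \<longleftrightarrow> incidence N (\<alpha> x) (\<alpha> y)"
    and col: "\<And>v. colour (\<alpha> v) = colour v"
    by (auto simp: graph_iso_def fun_eq_iff)
  have "\<forall>a. \<exists>b. \<alpha> (Elem a) = Elem b" "\<forall>xs. \<exists>ys. \<alpha> (Tup xs) = Tup ys"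
    "\<forall>xs j. \<exists>ys. \<alpha> (Pos xs j) = Pos ys j"
    by (simp_all add: col flip: colour_eq_iff)
  then obtain g t p where g: "\<And>a. \<alpha> (Elem a) = Elem (g a)" and t: "\<And>xs. \<alpha> (Tup xs) = Tup (t xs)"
    and p: "\<And>xs j. \<alpha> (Pos xs j) = Pos (p xs j) j"
    by metis
  have symb: "\<alpha> (Symb i) = Symb i" for i
    by (simp add: col flip: colour_eq_iff)
  have inj: "\<alpha> v = \<alpha> w \<longleftrightarrow> v = w" for v w
    using bij_is_inj[OF \<alpha>(1)] by (simp add: inj_eq)
  have pos: "p xs j = t xs \<and> j < length (t xs)" if "j < length xs" for xs j
    using \<alpha>(2)[of "Tup xs" "Pos xs j"] that by (auto simp: incidence_def t p)
  have len: "length (t xs) = length xs" for xs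
  proof (rule antisym)
    show "length xs \<le> length (t xs)"
      using pos[of _ xs] by (meson le_less_linear less_irrefl)
    \<comment> \<open>By surjectivity a position of the image tuple comes from some
      \<open>Pos ys j\<close>; pulling back its edge to the tuple gives ys = xs.\<close>
    have "j < length xs" if j: "j < length (t xs)" for j
    proof -
      obtain v where v: "\<alpha> v = Pos (t xs) j" using bij_pointE[OF \<alpha>(1)] by metis
      then have "colour v = 4 + 2 * j" using col[of v] by simp
      then obtain ys where ys: "v = Pos ys j" using colour_eq_iff(3) by blast
      have "incidence M (Tup xs) v"
        using j by (simp add: \<alpha>(2) v t) (simp add: incidence_def)
      then show ?thesis by (simp add: incidence_def ys)
    qed
    then show "length (t xs) \<le> length xs" by (meson le_less_linear less_irrefl)
  qed
  have t_eq: "t xs = map g xs" for xs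
  proof (rule nth_equalityI)
    fix j assume "j < length (t xs)"
    then have j: "j < length xs" by (simp add: len)
    then have "incidence N (Elem (g (xs ! j))) (Pos (t xs) j)"
      using \<alpha>(2)[of "Elem (xs ! j)" "Pos xs j"] pos[OF j] by (simp add: g p) (simp add: incidence_def)
    then show "t xs ! j = map g xs ! j" using j by (simp add: incidence_def)
  qed (simp add: len)
  have "inj g" using inj[of "Elem _" "Elem _"] by (simp add: g inj_def)
  moreover have "\<exists>a. g a = b" for b
  proof -
    obtain v where v: "\<alpha> v = Elem b" using bij_pointE[OF \<alpha>(1)] by metis
    then have "colour v = 2" using col[of v] by simp
    then obtain a where "v = Elem a" using colour_eq_iff(1) by blast
    then show ?thesis using v by (auto simp: g)
  qed
  ultimately have "bij g" by (metis bijI surj_def)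
  moreover have "M i xs \<longleftrightarrow> N i (map g xs)" for i xs
    using \<alpha>(2)[of "Tup xs" "Symb i"] by (simp add: t symb t_eq) (simp add: incidence_def)
  ultimately show "struct_isomorphic M N" by (auto simp: struct_isomorphic_def)
qed

section \<open>Transfer to graphs on the natural numbers\<close>

lemma graph_isomorphic_pullback:
  assumes "bij d"
  shows "graph_isomorphic (\<lambda>i j. E (d i) (d j)) (\<lambda>i j. F (d i) (d j)) \<longleftrightarrow> graph_isomorphic E F"
proof -
  have d: "graph_iso d UNIV (\<lambda>i j. H (d i) (d j)) UNIV H" for H
    using assms by (simp add: graph_iso_def)
  show ?thesis
    unfolding graph_isomorphic_def
    using graph_iso_comp[OF graph_iso_comp[OF d] graph_iso_inv[OF d]]
      graph_iso_comp[OF graph_iso_comp[OF graph_iso_inv[OF d]] d] by blast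
qed

definition coding_graph :: "struct \<Rightarrow> nat \<Rightarrow> nat \<Rightarrow> bool" where
  "coding_graph M i j = with_leaves colour (incidence M)
     (from_nat_into UNIV i) (from_nat_into UNIV j)"

lemma bij_from_nat_vertex: "bij (from_nat_into UNIV :: nat \<Rightarrow> vertex \<times> nat)"
  by (rule bij_betw_from_nat_into) (simp_all add: finite_prod)

lemma graph_isomorphic_coding_graph_iff:
  "graph_isomorphic (coding_graph M) (coding_graph N) \<longleftrightarrow> struct_isomorphic M N"
  unfolding struct_isomorphic_iff_incidence coding_graph_def[abs_def]
    graph_isomorphic_pullback[OF bij_from_nat_vertex]
  by (rule graph_isomorphic_with_leaves_iff) (rule colour_ge_2)

lemma coding_graph_clique_free:
  assumes "n \<ge> 3"
  shows "simple_graph UNIV (coding_graph M)" "clique_free n UNIV (coding_graph M)"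
proof -
  \<comment> \<open>An original vertex keeps its side of the incidence graph and its leaves go to
    the opposite side, so both kinds of edges cross.\<close>
  define side :: "nat \<Rightarrow> bool" where
    "side i = (case from_nat_into UNIV i of (v, r) \<Rightarrow> left v \<noteq> (r > (0 :: nat)))" for i
  have side: "side i \<noteq> side j" if "coding_graph M i j" for i j
    using that incidence_left[of M]
    by (auto simp: coding_graph_def with_leaves_def side_def split: prod.splits)
  then show "clique_free n UNIV (coding_graph M)"
    using assms by (rule bipartite_clique_free)
  have "symp (coding_graph M)"
    by (auto simp: symp_def coding_graph_def with_leaves_def incidence_def)
  then show "simple_graph UNIV (coding_graph M)"
    using side by (auto simp: simple_graph_def irreflp_on_def)
qed

lemma borel_class_reducible:
  assumes n: "n \<ge> 3"
  shows "borel_reducible (restrict_space borel C) struct_isomorphic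
    (clique_free_graphs n) graph_isomorphic"
  unfolding borel_reducible_def
proof (intro bexI ballI)
  let ?M = "restrict_space borel C :: struct measure"
  show "struct_isomorphic M N \<longleftrightarrow> graph_isomorphic (coding_graph M) (coding_graph N)" for M N
    by (simp add: graph_isomorphic_coding_graph_iff)
  have M: "Measurable.pred ?M (\<lambda>M. M i xs)" for i xs
    by (rule pred_borel_coordinate) (simp add: measurable_restrict_space1)
  \<comment> \<open>For fixed x and y an arc is either constant in M or a single coordinate
    \<open>M i xs\<close>.\<close>
  have "Measurable.pred ?M (\<lambda>M. arc M x y)" for x y
    using M by (cases x; cases y) auto
  then have "Measurable.pred ?M (\<lambda>M. coding_graph M i j)" for i j
    unfolding coding_graph_def with_leaves_def incidence_def
    by (intro pred_intros_logic) auto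
  then have "coding_graph \<in> borel_measurable ?M" by (rule borel_measurable_relationI)
  then show "coding_graph \<in> ?M \<rightarrow>\<^sub>M clique_free_graphs n"
    unfolding clique_free_graphs_def
    using coding_graph_clique_free[OF n] by (intro measurable_restrict_space2) auto
qed

theorem theorem3p3:
  fixes n :: nat and \<Gamma> :: "nat \<Rightarrow> nat \<Rightarrow> bool"
  assumes "n \<ge> 3" and "generic_clique_free n \<Gamma>"
  shows "borel_reducible (clique_free_graphs n) graph_isomorphic
           (aut_space \<Gamma>) (conjugate_in (aut \<Gamma>))
         \<and> borel_complete (aut_space \<Gamma>) (conjugate_in (aut \<Gamma>))"
proof -
  have "borel_reducible (clique_free_graphs n) graph_isomorphic
      (aut_space \<Gamma>) (conjugate_in (aut \<Gamma>))"
    using assms by (intro clique_free_graphs_reducible) auto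
  moreover from this have "borel_complete (aut_space \<Gamma>) (conjugate_in (aut \<Gamma>))"
    unfolding borel_complete_def
    using borel_reducible_trans[OF borel_class_reducible[OF assms(1)]] by blast
  ultimately show ?thesis by blast
qed

end
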